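(* Let $k\ge 1$ be an integer, let $\psi:\mathbb{C}^{k+1}\to\mathbb{C}$, $\psi(z)=z_1\cdots z_{k+1}$, and let $F_i(z)=|z_i|^2-|z_{i+1}|^2$ for $i=1,\dots,k$. Let $\gamma\subset\mathbb{C}$ be a smooth embedded closed curve admissible for the twist torus $\Theta^k$ (see context), and let $\gamma_1\subset\mathbb{C}\setminus\{0\}$ be the image under $\psi$ of the loop $\{\tfrac{1}{\sqrt{k+1}}(w,\dots,w): w\in\gamma\}$ in the diagonal $\Delta=\{z_1=\dots=z_{k+1}\}$, i.e. the loop obtained by taking $(k+1)$-th powers of the common coordinate: $\gamma_1=\{(w/\sqrt{k+1})^{k+1}: w\in\gamma\}$. Then the torus $$S_{\gamma_1,(0,\dots,0)}=\{z\in\mathbb{C}^{k+1}: \psi(z)\in\gamma_1,\ F_1(z)=\dots=F_k(z)=0\}$$ coincides with the twist torus $\Theta^k$ defined by the curve $\gamma$.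
   Context: Twist torus (Chekanov--Schlenk): consider the open sector $\mathcal{S}(k)=\{re^{i\phi}: r>0,\ 0<\phi<\frac{2\pi}{k+1}\}\subset\mathbb{C}$ and the open disc $D^2(k+1+\epsilon)\subset\mathbb{C}$ of area $k+1+\epsilon$ centered at the origin, where $\epsilon>0$. A smooth embedded closed curve $\gamma\subset\mathbb{C}$ is admissible if it lies in $\mathcal{S}(k)\cap D^2(k+1+\epsilon)$ and encloses a domain of area $1$. The associated twist torus is $$\Theta^k=\left\{\tfrac{1}{\sqrt{k+1}}\left(e^{i\alpha_1}w,\dots,e^{i\alpha_{k+1}}w\right) : w\in\gamma,\ \alpha_1,\dots,\alpha_{k+1}\in\mathbb{R},\ \sum_{j=1}^{k+1}\alpha_j=0\right\}\subset\mathbb{C}^{k+1}.$$ *)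

theory Defs
  imports "HOL-Analysis.Analysis"
begin

(* The space of n complex coordinates z_1, ..., z_n, for a number n that is a term: extensional
   functions on {1..n}, so that equality of points is equality of the n coordinates. *)
definition cspace :: "nat \<Rightarrow> (nat \<Rightarrow> complex) set" where
  "cspace n = {1..n} \<rightarrow>\<^sub>E UNIV"

definition smooth :: "(real \<Rightarrow> complex) \<Rightarrow> bool" where
  "smooth c \<longleftrightarrow>
     (\<forall>m. ((\<lambda>f t. vector_derivative f (at t)) ^^ m) c differentiable_on UNIV)"

(* Images of smooth embeddings of the circle, viewed as the quotient of the reals by the integers:
   for a map on a compact source, an embedding is the same as an injective immersion. *)
definition smooth_embedded_closed_curve :: "complex set \<Rightarrow> bool" where
  "smooth_embedded_closed_curve \<gamma> \<longleftrightarrow>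
     (\<exists>c :: real \<Rightarrow> complex. smooth c \<and> (\<forall>t. c (t + 1) = c t) \<and>
        inj_on c {0..<1} \<and> (\<forall>t. vector_derivative c (at t) \<noteq> 0) \<and> \<gamma> = range c)"

definition sector :: "nat \<Rightarrow> complex set" where
  "sector k = {of_real r * cis \<phi> | r \<phi>. 0 < r \<and> 0 < \<phi> \<and> \<phi> < 2 * pi / real (k + 1)}"

(* The argument is the area of the disc, not its radius. *)
definition disc :: "real \<Rightarrow> complex set" where
  "disc a = ball 0 (sqrt (a / pi))"

lemma measure_disc:
  assumes "0 \<le> a"
  shows "measure lebesgue (disc a) = a"
  using assms by (simp add: disc_def content_ball unit_ball_vol_2)

definition admissible :: "nat \<Rightarrow> real \<Rightarrow> complex set \<Rightarrow> bool" where
  "admissible k \<epsilon> \<gamma> \<longleftrightarrow>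
     smooth_embedded_closed_curve \<gamma> \<and>
     \<gamma> \<subseteq> sector k \<inter> disc (real (k + 1) + \<epsilon>) \<and>
     measure lebesgue (inside \<gamma>) = 1"

definition twist_torus :: "nat \<Rightarrow> complex set \<Rightarrow> (nat \<Rightarrow> complex) set" where
  "twist_torus k \<gamma> =
     {(\<lambda>j\<in>{1..k + 1}. of_real (1 / sqrt (real (k + 1))) * (cis (\<alpha> j) * w)) | w \<alpha>.
        w \<in> \<gamma> \<and> (\<Sum>j = 1..k + 1. \<alpha> j) = (0::real)}"

definition \<psi> :: "nat \<Rightarrow> (nat \<Rightarrow> complex) \<Rightarrow> complex" where
  "\<psi> k z = (\<Prod>j = 1..k + 1. z j)"

definition F :: "nat \<Rightarrow> (nat \<Rightarrow> complex) \<Rightarrow> real" where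
  "F i z = (cmod (z i))\<^sup>2 - (cmod (z (i + 1)))\<^sup>2"

definition S_torus :: "nat \<Rightarrow> complex set \<Rightarrow> (nat \<Rightarrow> real) \<Rightarrow> (nat \<Rightarrow> complex) set" where
  "S_torus k \<Gamma> c = {z \<in> cspace (k + 1). \<psi> k z \<in> \<Gamma> \<and> (\<forall>i\<in>{1..k}. F i z = c i)}"

definition diagonal_loop :: "nat \<Rightarrow> complex set \<Rightarrow> (nat \<Rightarrow> complex) set" where
  "diagonal_loop k \<gamma> = {(\<lambda>j\<in>{1..k + 1}. of_real (1 / sqrt (real (k + 1))) * w) | w. w \<in> \<gamma>}"

lemma psi_diagonal_loop:
  "\<psi> k ` diagonal_loop k \<gamma> = {(w / of_real (sqrt (real (k + 1)))) ^ (k + 1) | w. w \<in> \<gamma>}"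
proof -
  have "\<psi> k (\<lambda>j\<in>{1..k + 1}. of_real (1 / sqrt (real (k + 1))) * w)
          = (w / of_real (sqrt (real (k + 1)))) ^ (k + 1)" for w
    unfolding \<psi>_def by (simp add: prod.cong)
  then show ?thesis
    unfolding diagonal_loop_def by (auto simp: image_iff) metis+
qed

lemma zero_notin_psi_diagonal_loop:
  assumes "admissible k \<epsilon> \<gamma>"
  shows "0 \<notin> \<psi> k ` diagonal_loop k \<gamma>"
proof -
  have "w \<noteq> 0" if "w \<in> \<gamma>" for w
    using assms that unfolding admissible_def sector_def by auto
  then show ?thesis
    unfolding psi_diagonal_loop by auto
qed

end

theory Submission
  imports Defs
begin

text \<open>
  A point of the left-hand side has coordinates of equal modulus and the same product as some
  diagonal point with entries \<open>w / sqrt (k + 1)\<close>, so every coordinate is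
  \<open>w / sqrt (k + 1)\<close> times a unit complex number. These units have product 1, so their
  arguments sum to a multiple of \<open>2 * pi\<close>, which can be absorbed into one of them.
\<close>

lemma prod_cis_eq: "(\<Prod>j\<in>A. cis (f j)) = cis (\<Sum>j\<in>A. f j)"
  \<comment> \<open>For infinite \<open>A\<close> the product defaults to 1 and the sum to 0, and
    \<open>cis 0 = 1\<close>.\<close>
  by (induction A rule: infinite_finite_induct) (simp_all add: cis_mult)

lemma cis_eq_1_imp_multiple_2pi:
  assumes "cis x = 1"
  obtains m :: int where "x = 2 * pi * of_int m"
proof -
  have "cos x = 1"
    using assms by (simp add: complex_eq_iff)
  then show ?thesis
    using that by (auto simp: cos_one_2pi_int)
qed

text \<open>The twist torus asks for angles with sum exactly 0, whereas \<open>prod1\<close> fixes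
  the sum of the principal arguments only modulo 2 pi. The index \<open>a\<close> is where the
  excess is subtracted; whole turns do not change \<open>cis\<close>.\<close>

lemma unit_complex_prod_1_imp_cis_sum_0:
  fixes u :: "'a \<Rightarrow> complex"
  assumes "finite A" and a: "a \<in> A" and norm1: "\<And>j. j \<in> A \<Longrightarrow> cmod (u j) = 1"
    and prod1: "prod u A = 1"
  obtains \<alpha> where "\<And>j. j \<in> A \<Longrightarrow> u j = cis (\<alpha> j)" and "sum \<alpha> A = 0"
proof -
  have u: "u j = cis (Arg (u j))" if "j \<in> A" for j
    using rcis_cmod_Arg[of "u j"] norm1[OF that] by (simp add: rcis_def)
  have "cis (\<Sum>j\<in>A. Arg (u j)) = 1"
    using prod1 u by (simp flip: prod_cis_eq cong: prod.cong)
  then obtain m :: int where m: "(\<Sum>j\<in>A. Arg (u j)) = 2 * pi * of_int m"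
    by (rule cis_eq_1_imp_multiple_2pi)
  define \<alpha> where "\<alpha> j = Arg (u j) - (if j = a then 2 * pi * of_int m else 0)" for j
  have "u j = cis (\<alpha> j)" if "j \<in> A" for j
    using u[OF that] by (simp add: \<alpha>_def flip: cis_divide)
  moreover have "sum \<alpha> A = 0"
    using assms(1) a m by (simp add: \<alpha>_def sum_subtractf)
  ultimately show ?thesis
    using that by blast
qed

lemma equal_moduli_if_F_zero:
  assumes "\<forall>i\<in>{1..k}. F i z = 0" and "j \<in> {1..k + 1}"
  shows "cmod (z j) = cmod (z 1)"
proof -
  have "1 \<le> j" "j \<le> k + 1"
    using assms(2) by auto
  then show ?thesis
  proof (induction j rule: dec_induct)
    case base
    show ?case ..
  next
    case (step i)
    \<comment> \<open>The induction step has \<open>i < k + 1\<close>, so \<open>i\<close> is in the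
      range \<open>{1..k}\<close> of the constraints.\<close>
    then have "F i z = 0"
      using assms(1) by auto
    then have "cmod (z i) = cmod (z (i + 1))"
      by (simp add: F_def)
    with step show ?case
      by simp
  qed
qed

theorem proposition1p2:
  fixes k :: nat and \<epsilon> :: real and \<gamma> \<gamma>\<^sub>1 :: "complex set"
  assumes "k \<ge> 1" and "\<epsilon> > 0"
    and "admissible k \<epsilon> \<gamma>"
    and "\<gamma>\<^sub>1 = \<psi> k ` diagonal_loop k \<gamma>"
  shows "S_torus k \<gamma>\<^sub>1 (\<lambda>_. 0) = twist_torus k \<gamma>"
proof
  let ?I = "{1..k + 1}"
  define s where "s = sqrt (real (k + 1))"
  have s: "s > 0"
    by (simp add: s_def)
  have \<gamma>\<^sub>1: "\<gamma>\<^sub>1 = {(w / of_real s) ^ (k + 1) | w. w \<in> \<gamma>}"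
    unfolding assms(4) psi_diagonal_loop s_def ..
  show "S_torus k \<gamma>\<^sub>1 (\<lambda>_. 0) \<subseteq> twist_torus k \<gamma>"
  proof
    fix z assume "z \<in> S_torus k \<gamma>\<^sub>1 (\<lambda>_. 0)"
    then have ext: "z \<in> extensional ?I" and "\<psi> k z \<in> \<gamma>\<^sub>1" and Fz: "\<forall>i\<in>{1..k}. F i z = 0"
      by (auto simp: S_torus_def cspace_def PiE_def)
    then obtain w where w: "w \<in> \<gamma>" and prod_z: "(\<Prod>j\<in>?I. z j) = (w / of_real s) ^ (k + 1)"
      unfolding \<gamma>\<^sub>1 \<psi>_def by auto
    define v where "v = w / of_real s"
    \<comment> \<open>The sector omits the origin, so the coordinates can be divided by
      \<open>v\<close>.\<close>
    have "w \<noteq> 0"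
      using assms(3) w unfolding admissible_def sector_def by auto
    then have v: "v \<noteq> 0"
      using s by (simp add: v_def)
    have eq_mod: "cmod (z j) = cmod (z 1)" if "j \<in> ?I" for j
      using Fz that by (rule equal_moduli_if_F_zero)
    \<comment> \<open>The product determines the common modulus: its power with exponent
      \<open>k + 1\<close> is that of \<open>cmod v\<close>, and nonnegative roots are
      unique.\<close>
    have "cmod (z 1) ^ (k + 1) = (\<Prod>j\<in>?I. cmod (z 1))"
      by simp
    also have "\<dots> = (\<Prod>j\<in>?I. cmod (z j))"
      by (intro prod.cong refl eq_mod[symmetric])
    also have "\<dots> = cmod (v ^ (k + 1))"
      unfolding prod_norm prod_z v_def ..
    also have "\<dots> = cmod v ^ (k + 1)"
      by (rule norm_power)
    finally have "cmod (z 1) = cmod v"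
      by (rule power_eq_imp_eq_base) auto
    then have "cmod (z j / v) = 1" if "j \<in> ?I" for j
      using eq_mod[OF that] v by (simp add: norm_divide)
    moreover have "(\<Prod>j\<in>?I. z j / v) = 1"
      using prod_z v by (simp add: prod_dividef flip: v_def)
    ultimately obtain \<alpha> where \<alpha>: "\<And>j. j \<in> ?I \<Longrightarrow> z j / v = cis (\<alpha> j)" and sum_\<alpha>: "sum \<alpha> ?I = 0"
      using unit_complex_prod_1_imp_cis_sum_0[of ?I 1 "\<lambda>j. z j / v"] by auto
    have "z j = of_real (1 / s) * (cis (\<alpha> j) * w)" if "j \<in> ?I" for j
      using \<alpha>[OF that] v s by (simp add: v_def field_simps)
    \<comment> \<open>Both functions are \<open>undefined\<close> outside \<open>?I\<close>, so
      agreement on the \<open>k + 1\<close> coordinates suffices.\<close>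
    then have "z = (\<lambda>j\<in>?I. of_real (1 / s) * (cis (\<alpha> j) * w))"
      by (intro extensionalityI[OF ext restrict_extensional]) simp
    then show "z \<in> twist_torus k \<gamma>"
      using w sum_\<alpha> unfolding twist_torus_def s_def by blast
  qed
  show "twist_torus k \<gamma> \<subseteq> S_torus k \<gamma>\<^sub>1 (\<lambda>_. 0)"
  proof
    fix z assume "z \<in> twist_torus k \<gamma>"
    then obtain w \<alpha> where z: "z = (\<lambda>j\<in>?I. of_real (1 / s) * (cis (\<alpha> j) * w))"
      and w: "w \<in> \<gamma>" and sum_\<alpha>: "sum \<alpha> ?I = 0"
      unfolding twist_torus_def s_def by blast
    have "\<psi> k z = (\<Prod>j\<in>?I. cis (\<alpha> j) * (w / of_real s))"
      unfolding \<psi>_def z by (intro prod.cong) simp_all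
    \<comment> \<open>The twists multiply to \<open>cis 0 = 1\<close> and leave the product of the
      diagonal point.\<close>
    also have "\<dots> = (w / of_real s) ^ (k + 1)"
      using sum_\<alpha> by (simp only: prod.distrib prod_cis_eq) simp
    finally have "\<psi> k z \<in> \<gamma>\<^sub>1"
      using w unfolding \<gamma>\<^sub>1 by blast
    \<comment> \<open>Twisting preserves moduli. As \<open>i\<close> is at most \<open>k\<close>,
      both \<open>i\<close> and \<open>i + 1\<close> lie in \<open>?I\<close>, so each modulus is
      \<open>cmod w / s\<close>.\<close>
    moreover have "F i z = 0" if "i \<in> {1..k}" for i
      using that by (simp add: F_def z norm_mult norm_divide)
    moreover have "z \<in> cspace (k + 1)"
      by (simp add: z cspace_def PiE_def)
    ultimately show "z \<in> S_torus k \<gamma>\<^sub>1 (\<lambda>_. 0)"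
      by (simp add: S_torus_def)
  qed
qed

end
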